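(* Let $l\geq 1$ be an integer and let $G$ be a finite simple graph of order $n$, containing at least three pairwise nonadjacent vertices, with vertex connectivity $\kappa(G)\geq l+1$. If $\sigma_3(G)\geq n+2l$, then $G$ is a $(P_{\geq 3},l)$-factor critical graph.
   Context: All graphs are finite and simple. The order of a graph is its number of vertices, $d_G(x)$ is the degree of the vertex $x$ in $G$, and $\kappa(G)$ denotes the vertex connectivity of $G$ (with $\kappa(K_n)=n-1$). For a graph $G$ containing at least $k$ independent (pairwise nonadjacent) vertices, the degree sum is $$\sigma_k(G)=\min\Big\{\sum_{x\in X}d_G(x): X\subseteq V(G) \text{ is an independent set with } |X|=k\Big\}.$$ A $P_{\geq k}$-factor of a graph $G$ (for an integer $k\geq 2$) is a spanning subgraph of $G$ each of whose components is isomorphic to a path of order at least $k$. A graph $G$ is a $(P_{\geq k},l)$-factor critical graph if $G-V'$ contains a $P_{\geq k}$-factor for every $V'\subseteq V(G)$ with $|V'|=l$, where $G-V'$ is the subgraph induced by $V(G)\setminus V'$. *)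

theory Defs
  imports "Graph_Theory.Graph_Theory"
begin

text \<open>
  Finite simple graphs are the locale \<^locale>\<open>graph\<close>: finite, loop-free, symmetric digraphs without
  parallel arcs. An undirected edge is a pair of opposite arcs, so the degree of a vertex is its
  \<^const>\<open>out_degree\<close>, and the components of a graph are its \<^const>\<open>pre_digraph.sccs\<close>.
\<close>

definition independent_set :: "('a,'b) pre_digraph \<Rightarrow> 'a set \<Rightarrow> bool" where
  "independent_set G X \<longleftrightarrow> X \<subseteq> verts G \<and> (\<forall>x\<in>X. \<forall>y\<in>X. \<not> x \<rightarrow>\<^bsub>G\<^esub> y)"

text \<open>Only meaningful if \<open>G\<close> has an independent set of size \<open>k\<close>: otherwise this is \<^const>\<open>Min\<close> of the
  empty set.\<close>

definition degree_sum :: "nat \<Rightarrow> ('a,'b) pre_digraph \<Rightarrow> nat" where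
  "degree_sum k G = Min {\<Sum>x\<in>X. out_degree G x | X. independent_set G X \<and> card X = k}"

text \<open>A graph that is not complete has a separating set, namely the complement of two nonadjacent
  vertices. As \<open>S\<close> is a proper subset, the remaining graph is never empty.\<close>

definition vertex_connectivity :: "('a,'b) pre_digraph \<Rightarrow> nat" where
  "vertex_connectivity G =
    (if complete_digraph (card (verts G)) G then card (verts G) - 1
     else Min {card S | S. S \<subset> verts G \<and> \<not> connected (G \<restriction> (verts G - S))})"

definition path_graph :: "nat \<Rightarrow> nat pair_pre_digraph" where
  "path_graph m = \<lparr> pverts = {..<m}, parcs = {(i, j). i < m \<and> j < m \<and> (j = Suc i \<or> i = Suc j)} \<rparr>"

text \<open>\<^const>\<open>spanning\<close> alone would allow \<open>H\<close> to contain only one of two opposite arcs, which is not a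
  subgraph in the undirected sense; hence \<^term>\<open>graph H\<close>.\<close>

definition path_factor :: "nat \<Rightarrow> ('a,'b) pre_digraph \<Rightarrow> ('a,'b) pre_digraph \<Rightarrow> bool" where
  "path_factor k H G \<longleftrightarrow> graph H \<and> spanning H G \<and>
    (\<forall>C\<in>pre_digraph.sccs H. \<exists>m\<ge>k. digraph_iso C (with_proj (path_graph m)))"

definition path_factor_critical :: "nat \<Rightarrow> nat \<Rightarrow> ('a,'b) pre_digraph \<Rightarrow> bool" where
  "path_factor_critical k l G \<longleftrightarrow>
    (\<forall>S \<subseteq> verts G. card S = l \<longrightarrow> (\<exists>H. path_factor k H (G \<restriction> (verts G - S))))"

end

theory Submission
  imports Defs
begin

text \<open>
  Removing \<open>l\<close> vertices leaves a connected graph \<open>H\<close> on \<open>m \<ge> 3\<close> vertices in which any three pairwise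
  nonadjacent vertices have degree sum at least \<open>m\<close>. Instead of using Kaneko's characterisation of
  graphs with a \<open>P\<^sub>\<ge>\<^sub>3\<close>-factor, take disjoint paths of orders 3, 4, 5 covering as many vertices of \<open>H\<close>
  as possible. An uncovered vertex that has no uncovered neighbour can only be attached to an
  interior vertex of a path \<open>xyz\<close> or \<open>wxyz\<close>, or to the centre of a path \<open>abcde\<close>; an uncovered edge
  can only be attached to the centre of a path \<open>abcde\<close>. In each case three leaves of the resulting
  tree are pairwise nonadjacent, have no uncovered neighbour outside the tree, and jointly send at
  most \<open>|Q|\<close> edges to every other path \<open>Q\<close> and fewer edges into the tree than the tree has vertices:
  any further edge would allow a local rearrangement covering more vertices. Their degree sum is
  therefore less than \<open>m\<close>.
\<close>

section \<open>Maximum packings of paths\<close>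

locale adjacency =
  fixes E :: "'a \<Rightarrow> 'a \<Rightarrow> bool"
  assumes E_sym: "E x y \<Longrightarrow> E y x" and E_irrefl: "\<not> E x x"
begin

lemma E_commute: "E x y \<longleftrightarrow> E y x"
  using E_sym by blast

abbreviation nbrs :: "'a \<Rightarrow> 'a list \<Rightarrow> nat" where
  "nbrs x xs \<equiv> length (filter (E x) xs)"

text \<open>Path lengths have no upper bound, so that a rearrangement may contain paths of six or
  seven vertices.\<close>

definition packing :: "'a set \<Rightarrow> 'a list list \<Rightarrow> bool" where
  "packing W ps \<longleftrightarrow> (\<forall>p\<in>set ps. 3 \<le> length p \<and> successively E p) \<and>
     distinct (concat ps) \<and> set (concat ps) \<subseteq> W"

text \<open>Maximality is an upper bound attached to a vertex set rather than to one packing, so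
  that it passes from the whole graph to the few vertices of a rearrangement.\<close>

definition covers_at_most :: "'a set \<Rightarrow> nat \<Rightarrow> bool" where
  "covers_at_most W N \<longleftrightarrow> (\<forall>ps. packing W ps \<longrightarrow> length (concat ps) \<le> N)"

lemma covers_at_mostD: "covers_at_most W N \<Longrightarrow> packing W ps \<Longrightarrow> length (concat ps) \<le> N"
  by (simp add: covers_at_most_def)

lemma packing_append:
  assumes "packing A ps" "packing B qs" "A \<inter> B = {}" "A \<union> B \<subseteq> W"
  shows "packing W (ps @ qs)"
  using assms unfolding packing_def by (simp only: set_append concat_append distinct_append) blast

text \<open>Any packing of \<open>A\<close> extends by \<open>ps\<close> to one of \<open>W\<close>.
  This localises maximality: once the other paths are removed, a rearrangement is tested inside a
  small block only.\<close>

lemma covers_at_most_remove: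
  assumes "covers_at_most W (N + length (concat ps))" "packing B ps" "A \<inter> B = {}" "A \<union> B \<subseteq> W"
  shows "covers_at_most A N"
  unfolding covers_at_most_def
proof (intro allI impI)
  fix qs assume "packing A qs"
  then have "packing W (qs @ ps)" using assms packing_append by blast
  from covers_at_mostD[OF assms(1) this] show "length (concat qs) \<le> N" by simp
qed

lemma covers_at_most_remove1:
  assumes "covers_at_most W M" "successively E p" "3 \<le> length p" "distinct p"
    "A \<inter> set p = {}" "A \<union> set p \<subseteq> W" "M = N + length p"
  shows "covers_at_most A N"
  using covers_at_most_remove[of W N "[p]" "set p" A] assms by (simp add: packing_def)

section \<open>Edges from uncovered vertices and tree leaves to a single path\<close>

lemma short_cases:
  assumes "length Q \<in> {3,4,5}"
  obtains (3) a b c where "Q = [a,b,c]" | (4) a b c d where "Q = [a,b,c,d]"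
    | (5) a b c d e where "Q = [a,b,c,d,e]"
  using assms by (auto simp: numeral_eq_Suc length_Suc_conv)

text \<open>Each excluded edge, or pair of edges, yields a packing of all of \<open>u # Q\<close>.
  What survives is the centre of a path of 3 or 5 vertices, or one of the two interior vertices of a
  path of 4.\<close>

lemma isolated_nbrs:
  assumes Q: "length Q \<in> {3,4,5}" "successively E Q" "distinct (u # Q)"
    and max: "covers_at_most (set (u # Q)) (length Q)"
  shows "nbrs u Q \<le> 1"
  using Q(1)
proof (cases rule: short_cases)
  case (3 a b c)
  have "\<not> E u a" "\<not> E u c"
    using max[THEN covers_at_mostD, of "[[u,a,b,c]]"] max[THEN covers_at_mostD, of "[[a,b,c,u]]"] Q 3
    by (auto simp: packing_def E_commute)
  then show ?thesis using 3 by simp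
next
  case (4 a b c d)
  have "\<not> E u a" "\<not> E u d" "\<not> (E u b \<and> E u c)"
    using max[THEN covers_at_mostD, of "[[u,a,b,c,d]]"] max[THEN covers_at_mostD, of "[[a,b,c,d,u]]"]
     max[THEN covers_at_mostD, of "[[a,b,u,c,d]]"] Q 4
    by (auto simp: packing_def E_commute)
  then show ?thesis using 4 by simp
next
  case (5 a b c d e)
  \<comment> \<open>A neighbour next to an end lets \<open>Q\<close> be cut so that
    \<open>u # Q\<close> becomes two paths of three vertices.\<close>
  have "\<not> E u a" "\<not> E u b" "\<not> E u d" "\<not> E u e"
    using max[THEN covers_at_mostD, of "[[u,a,b,c,d,e]]"] max[THEN covers_at_mostD, of "[[a,b,c,d,e,u]]"]
     max[THEN covers_at_mostD, of "[[a,b,u],[c,d,e]]"] max[THEN covers_at_mostD, of "[[a,b,c],[u,d,e]]"] Q 5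
    by (auto simp: packing_def E_commute)
  then show ?thesis using 5 by simp
qed

text \<open>Running from \<open>u\<close> through \<open>v\<close> into \<open>Q\<close> gains two
  vertices. Entering a path of 3 or 4 vertices drops at most one, and entering a path of 5 off its
  centre drops none, possibly after a cut into two paths. Entering at the centre of 5 drops two,
  which is a tie.\<close>

lemma edge_nbrs:
  assumes Q: "length Q \<in> {3,4,5}" "successively E Q" "distinct (u # v # Q)" and uv: "E u v"
    and max: "covers_at_most (set (u # v # Q)) (length Q)"
  shows "nbrs v Q \<le> 1" and "x \<in> set Q \<Longrightarrow> E v x \<Longrightarrow> length Q = 5 \<and> x = Q ! 2"
proof -
  have "nbrs v Q \<le> 1 \<and> (\<forall>x\<in>set Q. E v x \<longrightarrow> length Q = 5 \<and> x = Q ! 2)"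
    using Q(1)
  proof (cases rule: short_cases)
    case (3 a b c)
    have "\<not> E v a" "\<not> E v b" "\<not> E v c"
      using max[THEN covers_at_mostD, of "[[u,v,a,b,c]]"] max[THEN covers_at_mostD, of "[[u,v,b,a]]"]
        max[THEN covers_at_mostD, of "[[a,b,c,v,u]]"] Q uv 3
      by (auto simp: packing_def E_commute)
    then show ?thesis using 3 by simp
  next
    case (4 a b c d)
    have "\<not> E v a" "\<not> E v d" "\<not> E v b" "\<not> E v c"
      using max[THEN covers_at_mostD, of "[[u,v,a,b,c,d]]"] max[THEN covers_at_mostD, of "[[a,b,c,d,v,u]]"]
        max[THEN covers_at_mostD, of "[[u,v,b,c,d]]"] max[THEN covers_at_mostD, of "[[a,b,c,v,u]]"] Q uv 4
      by (auto simp: packing_def E_commute)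
    then show ?thesis using 4 by simp
  next
    case (5 a b c d e)
    have "\<not> E v a" "\<not> E v b" "\<not> E v d" "\<not> E v e"
      using max[THEN covers_at_mostD, of "[[u,v,a,b,c,d,e]]"] max[THEN covers_at_mostD, of "[[a,b,c,d,e,v,u]]"]
        max[THEN covers_at_mostD, of "[[a,b,v,u],[c,d,e]]"] max[THEN covers_at_mostD, of "[[a,b,c],[u,v,d,e]]"] Q uv 5
      by (auto simp: packing_def E_commute)
    then show ?thesis using 5 by simp
  qed
  then show "nbrs v Q \<le> 1" "x \<in> set Q \<Longrightarrow> E v x \<Longrightarrow> length Q = 5 \<and> x = Q ! 2" by auto
qed

text \<open>The slack \<open>1\<close> occurs when a covered path was shortened by cutting off the edge \<open>uv\<close> in exchange
  for a single uncovered vertex.\<close>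

lemma half_covered_edge_nbrs:
  assumes Q: "length Q \<in> {3,4,5}" "successively E Q" "distinct (u # v # Q)" and uv: "E u v"
    and max: "covers_at_most (set (u # v # Q)) (length Q + 1)"
  shows "nbrs v Q \<le> 1 \<or> length Q = 4 \<and> nbrs v Q \<le> 2"
    and "length Q = 4 \<Longrightarrow> x \<in> set Q \<Longrightarrow> E v x \<Longrightarrow> x = Q ! 1 \<or> x = Q ! 2"
proof -
  have "(nbrs v Q \<le> 1 \<or> length Q = 4 \<and> nbrs v Q \<le> 2) \<and>
      (length Q = 4 \<longrightarrow> (\<forall>x\<in>set Q. E v x \<longrightarrow> x = Q ! 1 \<or> x = Q ! 2))"
    using Q(1)
  proof (cases rule: short_cases)
    case (3 a b c)
    have "\<not> E v a" "\<not> E v c"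
      using max[THEN covers_at_mostD, of "[[u,v,a,b,c]]"]
        max[THEN covers_at_mostD, of "[[a,b,c,v,u]]"] Q uv 3
      by (auto simp: packing_def E_commute)
    then show ?thesis using 3 by simp
  next
    case (4 a b c d)
    have "\<not> E v a" "\<not> E v d"
      using max[THEN covers_at_mostD, of "[[u,v,a,b,c,d]]"] max[THEN covers_at_mostD, of "[[a,b,c,d,v,u]]"]
        Q uv 4
      by (auto simp: packing_def E_commute)
    then show ?thesis using 4 by simp
  next
    case (5 a b c d e)
    have "\<not> E v a" "\<not> E v b" "\<not> E v d" "\<not> E v e"
      using max[THEN covers_at_mostD, of "[[u,v,a,b,c,d,e]]"] max[THEN covers_at_mostD, of "[[a,b,c,d,e,v,u]]"]
        max[THEN covers_at_mostD, of "[[a,b,v,u],[c,d,e]]"] max[THEN covers_at_mostD, of "[[a,b,c],[u,v,d,e]]"] Q uv 5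
      by (auto simp: packing_def E_commute)
    then show ?thesis using 5 by simp
  qed
  then show "nbrs v Q \<le> 1 \<or> length Q = 4 \<and> nbrs v Q \<le> 2"
    and "length Q = 4 \<Longrightarrow> x \<in> set Q \<Longrightarrow> E v x \<Longrightarrow> x = Q ! 1 \<or> x = Q ! 2" by auto
qed

text \<open>The leaves are interchangeable: any two form with \<open>y\<close> a path of three
  vertices, so the third counts as uncovered and has at most one neighbour on
  \<open>Q\<close>.\<close>

lemma star_nbrs:
  assumes Q: "length Q \<in> {3,4,5}" "successively E Q" "distinct ([x,y,z,u] @ Q)"
    and E: "E x y" "E y z" "E u y"
    and max: "covers_at_most (set ([x,y,z,u] @ Q)) (3 + length Q)"
  shows "nbrs x Q + nbrs z Q + nbrs u Q \<le> length Q"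
proof -
  have 1: "nbrs x Q \<le> 1"
    by (rule isolated_nbrs[OF Q(1,2)], use Q(3) in auto,
        rule covers_at_most_remove1[OF max, of "[u,y,z]"]) (use Q(3) E in auto)
  have 2: "nbrs z Q \<le> 1"
    by (rule isolated_nbrs[OF Q(1,2)], use Q(3) in auto,
        rule covers_at_most_remove1[OF max, of "[x,y,u]"]) (use Q(3) E in \<open>auto simp: E_commute\<close>)
  have 3: "nbrs u Q \<le> 1"
    by (rule isolated_nbrs[OF Q(1,2)], use Q(3) in auto,
        rule covers_at_most_remove1[OF max, of "[x,y,z]"]) (use Q(3) E in auto)
  show ?thesis using 1 2 3 Q(1) by auto
qed

text \<open>Either of \<open>w\<close> and \<open>u\<close> can be left uncovered in favour of the
  other, so each has at most one neighbour on \<open>Q\<close>. The bound for \<open>z\<close> can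
  be 2, but only when \<open>Q\<close> has four vertices, which absorbs the excess.\<close>

lemma fork_nbrs:
  assumes Q: "length Q \<in> {3,4,5}" "successively E Q" "distinct ([w,x,y,z,u] @ Q)"
    and E: "E w x" "E x y" "E y z" "E u x"
    and max: "covers_at_most (set ([w,x,y,z,u] @ Q)) (4 + length Q)"
  shows "nbrs w Q + nbrs z Q + nbrs u Q \<le> length Q"
proof -
  have 1: "nbrs w Q \<le> 1"
    by (rule isolated_nbrs[OF Q(1,2)], use Q(3) in auto,
        rule covers_at_most_remove1[OF max, of "[u,x,y,z]"]) (use Q(3) E in auto)
  have 2: "nbrs u Q \<le> 1"
    by (rule isolated_nbrs[OF Q(1,2)], use Q(3) in auto,
        rule covers_at_most_remove1[OF max, of "[w,x,y,z]"]) (use Q(3) E in auto)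
  \<comment> \<open>Covering only \<open>w, x, u\<close> gives away one vertex and frees the edge
    \<open>yz\<close>; this is the slack 1.\<close>
  have 3: "nbrs z Q \<le> 1 \<or> length Q = 4 \<and> nbrs z Q \<le> 2"
    by (rule half_covered_edge_nbrs[OF Q(1,2) _ E(3)], use Q(3) in auto,
        rule covers_at_most_remove1[OF max, of "[w,x,u]"]) (use Q(3) E in \<open>auto simp: E_commute\<close>)
  show ?thesis using 1 2 3 Q(1) by auto
qed

text \<open>When \<open>Q\<close> has four vertices, the separate bounds 2, 2, 1 add up to one too
  many; rearrangements that involve both \<open>a\<close> and \<open>e\<close> repair this.\<close>

lemma spider_nbrs:
  assumes Q: "length Q \<in> {3,4,5}" "successively E Q" "distinct ([a,b,c,d,e,u] @ Q)"
    and E: "E a b" "E b c" "E c d" "E d e" "E u c"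
    and max: "covers_at_most (set ([a,b,c,d,e,u] @ Q)) (5 + length Q)"
  shows "nbrs a Q + nbrs e Q + nbrs u Q \<le> length Q"
proof -
  have 1: "nbrs u Q \<le> 1"
    by (rule isolated_nbrs[OF Q(1,2)], use Q(3) in auto,
        rule covers_at_most_remove1[OF max, of "[a,b,c,d,e]"]) (use Q(3) E in auto)
  have ba: "covers_at_most (set (b # a # Q)) (length Q + 1)"
    by (rule covers_at_most_remove1[OF max, of "[u,c,d,e]"]) (use Q(3) E in auto)
  have de: "covers_at_most (set (d # e # Q)) (length Q + 1)"
    by (rule covers_at_most_remove1[OF max, of "[a,b,c,u]"]) (use Q(3) E in \<open>auto simp: E_commute\<close>)
  have dist: "distinct (b # a # Q)" "distinct (d # e # Q)" using Q(3) by auto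
  note a = half_covered_edge_nbrs[OF Q(1,2) dist(1) E_sym[OF E(1)] ba]
  note e = half_covered_edge_nbrs[OF Q(1,2) dist(2) E(4) de]
  show ?thesis
  proof (cases "length Q = 4")
    case False
    then show ?thesis using a(1) e(1) 1 Q(1) by auto
  next
    case True
    then obtain p q r s where Qs: "Q = [p,q,r,s]" by (auto simp: numeral_eq_Suc length_Suc_conv)
    have outer: "\<not> E a p" "\<not> E a s" "\<not> E e p" "\<not> E e s"
      using a(2)[of p] a(2)[of s] e(2)[of p] e(2)[of s] Q(3) Qs by auto
    \<comment> \<open>On \<open>Q\<close> only \<open>q\<close> and \<open>r\<close> can be adjacent
      to \<open>a\<close> or \<open>e\<close>. If both edges \<open>ar, eq\<close>, or both edges
      \<open>aq, er\<close>, were present, two paths would cover all ten vertices. So at most two of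
      these four edges remain.\<close>
    have "\<not> (E a r \<and> E e q)"
      using max[THEN covers_at_mostD, of "[[b,a,r,s],[p,q,e,d,c,u]]"] Q E Qs
      by (auto simp: packing_def E_commute)
    moreover have "\<not> (E a q \<and> E e r)"
      using max[THEN covers_at_mostD, of "[[d,e,r,s],[p,q,a,b,c,u]]"] Q E Qs
      by (auto simp: packing_def E_commute)
    ultimately have "nbrs a Q + nbrs e Q \<le> 2" using outer Qs by simp
    then show ?thesis using 1 True by simp
  qed
qed

text \<open>Three legs of two vertices meet at \<open>c\<close>. Any two of them form with
  \<open>c\<close> a path of five vertices, so the third is an uncovered edge to which
  \<open>edge_nbrs\<close> applies.\<close>

lemma long_spider_nbrs:
  assumes Q: "length Q \<in> {3,4,5}" "successively E Q" "distinct ([a,b,c,d,e,u,v] @ Q)"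
    and E: "E a b" "E b c" "E c d" "E d e" "E u c" "E u v"
    and max: "covers_at_most (set ([a,b,c,d,e,u,v] @ Q)) (5 + length Q)"
  shows "nbrs a Q + nbrs e Q + nbrs v Q \<le> length Q"
proof -
  have 1: "nbrs v Q \<le> 1"
    by (rule edge_nbrs(1)[OF Q(1,2) _ E(6)], use Q(3) in auto,
        rule covers_at_most_remove1[OF max, of "[a,b,c,d,e]"]) (use Q(3) E in auto)
  have 2: "nbrs a Q \<le> 1"
    by (rule edge_nbrs(1)[OF Q(1,2) _ E_sym[OF E(1)]], use Q(3) in auto,
        rule covers_at_most_remove1[OF max, of "[v,u,c,d,e]"]) (use Q(3) E in \<open>auto simp: E_commute\<close>)
  have 3: "nbrs e Q \<le> 1"
    by (rule edge_nbrs(1)[OF Q(1,2) _ E(4)], use Q(3) in auto,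
        rule covers_at_most_remove1[OF max, of "[v,u,c,b,a]"]) (use Q(3) E in \<open>auto simp: E_commute\<close>)
  show ?thesis using 1 2 3 Q(1) by auto
qed


section \<open>Paths of orders 3, 4, 5 and the count of degrees\<close>

definition compact_packing :: "'a list list \<Rightarrow> bool" where
  "compact_packing R \<longleftrightarrow> (\<forall>Q\<in>set R. length Q \<in> {3,4,5} \<and> successively E Q) \<and> distinct (concat R)"

lemma compact_packing_imp_packing: "compact_packing R \<Longrightarrow> set (concat R) \<subseteq> W \<Longrightarrow> packing W R"
  by (auto simp: compact_packing_def packing_def)

text \<open>A path of at least six vertices can give up its first three and keep at least three.
  Hence a maximum packing may be taken with orders 3, 4, 5 only, which makes the case analysis
  finite.\<close>

lemma split_path:
  "3 \<le> length p \<Longrightarrow> successively E p \<Longrightarrow>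
    \<exists>ps. concat ps = p \<and> (\<forall>q\<in>set ps. length q \<in> {3,4,5} \<and> successively E q)"
proof (induction p rule: length_induct)
  case (1 p)
  show ?case
  proof (cases "length p \<le> 5")
    case True
    then show ?thesis using 1(2,3) by (intro exI[of _ "[p]"]) auto
  next
    case False
    have "successively E (take 3 p @ drop 3 p)" using 1(3) by simp
    then have *: "successively E (take 3 p)" "successively E (drop 3 p)"
      unfolding successively_append_iff by blast+
    have "length (drop 3 p) < length p" "3 \<le> length (drop 3 p)" using False by auto
    with 1(1) *(2) obtain ps where
      "concat ps = drop 3 p" "\<forall>q\<in>set ps. length q \<in> {3,4,5} \<and> successively E q" by blast
    then show ?thesis using False *(1) by (intro exI[of _ "take 3 p # ps"]) auto
  qed
qed

lemma compact_packing_exists: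
  assumes "packing W ps"
  obtains R where "compact_packing R" "concat R = concat ps"
proof -
  have "\<forall>p\<in>set ps. 3 \<le> length p \<and> successively E p" using assms by (simp add: packing_def)
  then have "\<exists>R. (\<forall>Q\<in>set R. length Q \<in> {3,4,5} \<and> successively E Q) \<and> concat R = concat ps"
  proof (induction ps)
    case (Cons p ps)
    then obtain R where R: "\<forall>Q\<in>set R. length Q \<in> {3,4,5} \<and> successively E Q" "concat R = concat ps"
      by auto
    obtain qs where "concat qs = p" "\<forall>q\<in>set qs. length q \<in> {3,4,5} \<and> successively E q"
      using split_path[of p] Cons.prems by auto
    then show ?case using R by (intro exI[of _ "qs @ R"]) auto
  qed (auto intro: exI[of _ "[]"])
  then show ?thesis using that assms by (auto simp: compact_packing_def packing_def)
qed

lemma maximum_packing_exists: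
  assumes "finite W"
  obtains R where "compact_packing R" "set (concat R) \<subseteq> W" "covers_at_most W (length (concat R))"
proof -
  let ?P = "\<lambda>n. \<exists>ps. packing W ps \<and> length (concat ps) = n"
  have "?P 0" by (rule exI[of _ "[]"]) (simp add: packing_def)
  moreover have "\<forall>n. ?P n \<longrightarrow> n \<le> card W"
    using assms by (metis packing_def distinct_card card_mono)
  ultimately obtain n where n: "?P n" "\<And>m. ?P m \<Longrightarrow> m \<le> n"
    using Nat.ex_has_greatest_nat[of ?P 0 "card W"] by blast
  then obtain ps where ps: "packing W ps" "length (concat ps) = n" by blast
  from compact_packing_exists[OF ps(1)] obtain R where R: "compact_packing R" "concat R = concat ps" .
  have "covers_at_most W (length (concat R))"
    unfolding covers_at_most_def using n(2) ps(2) R(2) by auto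
  then show ?thesis using that[of R] R ps(1) by (simp add: packing_def)
qed

lemma nbrs_concat_le:
  assumes "\<forall>Q\<in>set R. nbrs x Q + nbrs y Q + nbrs z Q \<le> length Q"
  shows "nbrs x (concat R) + nbrs y (concat R) + nbrs z (concat R) \<le> length (concat R)"
  using assms by (induction R) auto

lemma nbrs_card: "distinct xs \<Longrightarrow> nbrs x xs = card {w\<in>set xs. E x w}"
  by (metis distinct_card distinct_filter set_filter)

text \<open>The degrees are summed along an enumeration of \<open>V\<close>: \<open>L\<close>
  contributes nothing, each path at most its order, and strictness comes from the block
  \<open>C\<close>.\<close>

lemma degree_count:
  assumes V: "V = set C \<union> set (concat R) \<union> L" "finite L" "distinct C" "distinct (concat R)"
      "set C \<inter> set (concat R) = {}" "L \<inter> (set C \<union> set (concat R)) = {}"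
    and L: "\<forall>w\<in>L. \<not> E x w \<and> \<not> E y w \<and> \<not> E z w"
    and R: "\<forall>Q\<in>set R. nbrs x Q + nbrs y Q + nbrs z Q \<le> length Q"
    and C: "nbrs x C + nbrs y C + nbrs z C < length C"
  shows "card {w\<in>V. E x w} + card {w\<in>V. E y w} + card {w\<in>V. E z w} < card V"
proof -
  obtain ls where ls: "set ls = L" "distinct ls" using V(2) finite_distinct_list by blast
  let ?vs = "C @ concat R @ ls"
  have vs: "distinct ?vs" "set ?vs = V" using V ls by auto
  have card: "card {w\<in>V. E t w} = nbrs t ?vs" for t
    using nbrs_card[OF vs(1), of t] unfolding vs(2) by (rule sym)
  have "nbrs x ls = 0" "nbrs y ls = 0" "nbrs z ls = 0" using L ls by (auto simp: filter_empty_conv)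
  then have "nbrs x ?vs + nbrs y ?vs + nbrs z ?vs < length ?vs"
    using C nbrs_concat_le[OF R] by simp
  moreover have "length ?vs = card V" using vs distinct_card by metis
  ultimately show ?thesis unfolding card by simp
qed

end

section \<open>Perfect packings under the degree sum condition\<close>

text \<open>Models the graph left after deleting \<open>l\<close> vertices. Connectedness takes the
  form \<open>cut_edge\<close> because it is applied to one or two uncovered vertices, to find a
  neighbour outside.\<close>

locale sigma3_graph = adjacency E for E :: "'a \<Rightarrow> 'a \<Rightarrow> bool" +
  fixes V :: "'a set"
  assumes finite_V: "finite V"
    and sigma3: "\<lbrakk>x \<in> V; y \<in> V; z \<in> V; x \<noteq> y; x \<noteq> z; y \<noteq> z; \<not> E x y; \<not> E x z; \<not> E y z\<rbrakk> \<Longrightarrow>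
      card V \<le> card {w\<in>V. E x w} + card {w\<in>V. E y w} + card {w\<in>V. E z w}"
    and card_V: "3 \<le> card V"
    and cut_edge: "\<lbrakk>A \<subseteq> V; A \<noteq> {}; A \<noteq> V\<rbrakk> \<Longrightarrow> \<exists>x\<in>A. \<exists>y\<in>V - A. E x y"
begin

text \<open>The block \<open>C\<close> consists of one or two uncovered vertices and the path they are attached to, which
  has \<open>k\<close> vertices; \<open>R\<close> holds the other paths.\<close>

lemma no_obstruction:
  assumes C: "distinct C" "set C \<subseteq> V" "set C \<inter> set (concat R) = {}"
    and R: "compact_packing R" "set (concat R) \<subseteq> V"
    and max: "covers_at_most V (k + length (concat R))"
    and xyz: "{x,y,z} \<subseteq> set C" "x \<noteq> y" "x \<noteq> z" "y \<noteq> z" "\<not> E x y" "\<not> E x z" "\<not> E y z"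
    and own: "nbrs x C + nbrs y C + nbrs z C < length C"
    and outer: "\<And>w. \<lbrakk>w \<in> V; w \<notin> set (concat R); w \<notin> set C; covers_at_most (set (w # C)) k\<rbrakk> \<Longrightarrow>
      \<not> E x w \<and> \<not> E y w \<and> \<not> E z w"
    and paths: "\<And>Q. \<lbrakk>length Q \<in> {3,4,5}; successively E Q; distinct (C @ Q);
      covers_at_most (set (C @ Q)) (k + length Q)\<rbrakk> \<Longrightarrow> nbrs x Q + nbrs y Q + nbrs z Q \<le> length Q"
  shows False
proof -
  have "card {w\<in>V. E x w} + card {w\<in>V. E y w} + card {w\<in>V. E z w} < card V"
  proof (rule degree_count[of V C R "V - set C - set (concat R)"])
    show "\<forall>w\<in>V - set C - set (concat R). \<not> E x w \<and> \<not> E y w \<and> \<not> E z w"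
    proof
      fix w assume w: "w \<in> V - set C - set (concat R)"
      \<comment> \<open>Removing all of \<open>R\<close> leaves the bound \<open>k\<close> on the
        block together with \<open>w\<close>, so edges to \<open>w\<close> can be refuted
        there.\<close>
      have "covers_at_most (set (w # C)) k"
        by (rule covers_at_most_remove[OF max compact_packing_imp_packing[OF R(1) subset_refl]])
          (use w C R in auto)
      then show "\<not> E x w \<and> \<not> E y w \<and> \<not> E z w" using outer w by blast
    qed
    show "\<forall>Q\<in>set R. nbrs x Q + nbrs y Q + nbrs z Q \<le> length Q"
    proof
      fix Q assume "Q \<in> set R"
      then obtain xs ys where R': "R = xs @ Q # ys" by (auto simp: in_set_conv_decomp)
      have *: "compact_packing (xs @ ys)" using R(1) R' by (auto simp: compact_packing_def)
      have "covers_at_most (set (C @ Q)) (k + length Q)"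
        by (rule covers_at_most_remove[OF _ compact_packing_imp_packing[OF * subset_refl], of V])
          (use max R C R' in \<open>auto simp: compact_packing_def add_ac\<close>)
      then show "nbrs x Q + nbrs y Q + nbrs z Q \<le> length Q"
        using paths[of Q] R(1) R' C by (auto simp: compact_packing_def)
    qed
  qed (use C R own finite_V in \<open>auto simp: compact_packing_def\<close>)
  moreover have "card V \<le> card {w\<in>V. E x w} + card {w\<in>V. E y w} + card {w\<in>V. E z w}"
    using sigma3[of x y z] xyz C(2) by blast
  ultimately show False by simp
qed

lemma covers_at_most_block:
  assumes C: "distinct C" "set C \<subseteq> V" "set C \<inter> set (concat R) = {}"
    and R: "compact_packing R" "set (concat R) \<subseteq> V"
    and max: "covers_at_most V (k + length (concat R))"
  shows "covers_at_most (set C) k"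
  by (rule covers_at_most_remove[OF max compact_packing_imp_packing[OF R(1) subset_refl]])
    (use C R in auto)

text \<open>Inside the tree the leaves see only \<open>y\<close>, which makes 3 edges into 4
  vertices. An uncovered neighbour of \<open>x\<close> or \<open>z\<close> would prolong the path
  \<open>x, y, z\<close>.\<close>

lemma star_obstruction:
  assumes C: "distinct [x,y,z,u]" "set [x,y,z,u] \<subseteq> V" "set [x,y,z,u] \<inter> set (concat R) = {}"
    and R: "compact_packing R" "set (concat R) \<subseteq> V"
    and max: "covers_at_most V (3 + length (concat R))"
    and E: "E x y" "E y z" "E u y"
    and isolated: "\<And>w. w \<in> V \<Longrightarrow> w \<notin> set (concat R) \<Longrightarrow> w \<notin> set [x,y,z] \<Longrightarrow> \<not> E u w"
  shows False
proof -
  note m = covers_at_most_block[OF C R max, THEN covers_at_mostD]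
  have i1: "\<not> E x z" using m[of "[[u,y,x,z]]"] C(1) E by (auto simp: packing_def E_commute)
  have i2: "\<not> E x u" using m[of "[[u,x,y,z]]"] C(1) E by (auto simp: packing_def E_commute)
  have i3: "\<not> E z u" using m[of "[[x,y,z,u]]"] C(1) E by (auto simp: packing_def E_commute)
  note indep = i1 i2 i3
  show False
  proof (rule no_obstruction[OF C R max, of x z u])
    show "nbrs x [x,y,z,u] + nbrs z [x,y,z,u] + nbrs u [x,y,z,u] < length [x,y,z,u]"
      using indep by (auto simp: E_irrefl E_commute)
    fix w assume w: "w \<in> V" "w \<notin> set (concat R)" "w \<notin> set [x,y,z,u]"
      and max: "covers_at_most (set (w # [x,y,z,u])) 3"
    show "\<not> E x w \<and> \<not> E z w \<and> \<not> E u w"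
      using max[THEN covers_at_mostD, of "[[w,x,y,z]]"] max[THEN covers_at_mostD, of "[[x,y,z,w]]"]
        isolated[of w] w E C(1) by (auto simp: packing_def E_commute)
  next
    fix Q assume "length Q \<in> {3,4,5}" "successively E Q" "distinct ([x,y,z,u] @ Q)"
      "covers_at_most (set ([x,y,z,u] @ Q)) (3 + length Q)"
    then show "nbrs x Q + nbrs z Q + nbrs u Q \<le> length Q" using star_nbrs E by blast
  qed (use C(1) indep in auto)
qed

text \<open>Inside the tree, \<open>w\<close> and \<open>u\<close> see only \<open>x\<close>, and
  \<open>z\<close> sees at most \<open>x\<close> and \<open>y\<close>: at most 4 edges into 5
  vertices.\<close>

lemma fork_obstruction:
  assumes C: "distinct [w,x,y,z,u]" "set [w,x,y,z,u] \<subseteq> V" "set [w,x,y,z,u] \<inter> set (concat R) = {}"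
    and R: "compact_packing R" "set (concat R) \<subseteq> V"
    and max: "covers_at_most V (4 + length (concat R))"
    and E: "E w x" "E x y" "E y z" "E u x"
    and isolated: "\<And>v. v \<in> V \<Longrightarrow> v \<notin> set (concat R) \<Longrightarrow> v \<notin> set [w,x,y,z] \<Longrightarrow> \<not> E u v"
  shows False
proof -
  note m = covers_at_most_block[OF C R max, THEN covers_at_mostD]
  have i1: "\<not> E w z" using m[of "[[u,x,y,z,w]]"] C(1) E by (auto simp: packing_def E_commute)
  have i2: "\<not> E w u" using m[of "[[u,w,x,y,z]]"] C(1) E by (auto simp: packing_def E_commute)
  have i3: "\<not> E z u" using m[of "[[w,x,y,z,u]]"] C(1) E by (auto simp: packing_def E_commute)
  have i4: "\<not> E u y" using m[of "[[w,x,u,y,z]]"] C(1) E by (auto simp: packing_def E_commute)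
  have i5: "\<not> E w y" using m[of "[[u,x,w,y,z]]"] C(1) E by (auto simp: packing_def E_commute)
  note indep = i1 i2 i3 i4 i5
  show False
  proof (rule no_obstruction[OF C R max, of w z u])
    show "nbrs w [w,x,y,z,u] + nbrs z [w,x,y,z,u] + nbrs u [w,x,y,z,u] < length [w,x,y,z,u]"
      using indep by (auto simp: E_irrefl E_commute)
    fix v assume v: "v \<in> V" "v \<notin> set (concat R)" "v \<notin> set [w,x,y,z,u]"
      and max: "covers_at_most (set (v # [w,x,y,z,u])) 4"
    show "\<not> E w v \<and> \<not> E z v \<and> \<not> E u v"
      using max[THEN covers_at_mostD, of "[[v,w,x,y,z]]"] max[THEN covers_at_mostD, of "[[w,x,y,z,v]]"]
        isolated[of v] v E C(1) by (auto simp: packing_def E_commute)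
  next
    fix Q assume "length Q \<in> {3,4,5}" "successively E Q" "distinct ([w,x,y,z,u] @ Q)"
      "covers_at_most (set ([w,x,y,z,u] @ Q)) (4 + length Q)"
    then show "nbrs w Q + nbrs z Q + nbrs u Q \<le> length Q" using fork_nbrs E by blast
  qed (use C(1) indep in auto)
qed

text \<open>Inside the tree, \<open>a\<close> sees at most \<open>b\<close> and \<open>c\<close>,
  \<open>e\<close> at most \<open>c\<close> and \<open>d\<close>, and \<open>u\<close> only
  \<open>c\<close>: at most 5 edges into 6 vertices.\<close>

lemma spider_obstruction:
  assumes C: "distinct [a,b,c,d,e,u]" "set [a,b,c,d,e,u] \<subseteq> V" "set [a,b,c,d,e,u] \<inter> set (concat R) = {}"
    and R: "compact_packing R" "set (concat R) \<subseteq> V"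
    and max: "covers_at_most V (5 + length (concat R))"
    and E: "E a b" "E b c" "E c d" "E d e" "E u c"
    and isolated: "\<And>w. w \<in> V \<Longrightarrow> w \<notin> set (concat R) \<Longrightarrow> w \<notin> set [a,b,c,d,e] \<Longrightarrow> \<not> E u w"
  shows False
proof -
  note m = covers_at_most_block[OF C R max, THEN covers_at_mostD]
  have i1: "\<not> E a e" using m[of "[[u,c,b,a,e,d]]"] C(1) E by (auto simp: packing_def E_commute)
  have i2: "\<not> E a u" using m[of "[[u,a,b,c,d,e]]"] C(1) E by (auto simp: packing_def E_commute)
  have i3: "\<not> E e u" using m[of "[[a,b,c,d,e,u]]"] C(1) E by (auto simp: packing_def E_commute)
  have i4: "\<not> E a d" using m[of "[[e,d,a,b,c,u]]"] C(1) E by (auto simp: packing_def E_commute)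
  have i5: "\<not> E e b" using m[of "[[a,b,e,d,c,u]]"] C(1) E by (auto simp: packing_def E_commute)
  have i6: "\<not> E u b" using m[of "[[a,b,u],[c,d,e]]"] C(1) E by (auto simp: packing_def E_commute)
  have i7: "\<not> E u d" using m[of "[[a,b,c],[u,d,e]]"] C(1) E by (auto simp: packing_def E_commute)
  note indep = i1 i2 i3 i4 i5 i6 i7
  show False
  proof (rule no_obstruction[OF C R max, of a e u])
    show "nbrs a [a,b,c,d,e,u] + nbrs e [a,b,c,d,e,u] + nbrs u [a,b,c,d,e,u] < length [a,b,c,d,e,u]"
      using indep by (auto simp: E_irrefl E_commute)
    fix w assume w: "w \<in> V" "w \<notin> set (concat R)" "w \<notin> set [a,b,c,d,e,u]"
      and max: "covers_at_most (set (w # [a,b,c,d,e,u])) 5"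
    show "\<not> E a w \<and> \<not> E e w \<and> \<not> E u w"
      using max[THEN covers_at_mostD, of "[[w,a,b,c,d,e]]"] max[THEN covers_at_mostD, of "[[a,b,c,d,e,w]]"]
        isolated[of w] w E C(1) by (auto simp: packing_def E_commute)
  next
    fix Q assume "length Q \<in> {3,4,5}" "successively E Q" "distinct ([a,b,c,d,e,u] @ Q)"
      "covers_at_most (set ([a,b,c,d,e,u] @ Q)) (5 + length Q)"
    then show "nbrs a Q + nbrs e Q + nbrs u Q \<le> length Q" using spider_nbrs E by blast
  qed (use C(1) indep in auto)
qed

text \<open>Inside the tree, each of \<open>a\<close>, \<open>e\<close>, \<open>v\<close> sees at
  most its partner on the leg and \<open>c\<close>: at most 6 edges into 7 vertices. An uncovered
  neighbour \<open>w\<close> of \<open>v\<close> would add the whole path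
  \<open>w, v, u\<close>.\<close>

lemma long_spider_obstruction:
  assumes C: "distinct [a,b,c,d,e,u,v]" "set [a,b,c,d,e,u,v] \<subseteq> V" "set [a,b,c,d,e,u,v] \<inter> set (concat R) = {}"
    and R: "compact_packing R" "set (concat R) \<subseteq> V"
    and max: "covers_at_most V (5 + length (concat R))"
    and E: "E a b" "E b c" "E c d" "E d e" "E u c" "E u v"
  shows False
proof -
  note m = covers_at_most_block[OF C R max, THEN covers_at_mostD]
  have i1: "\<not> E a e" using m[of "[[v,u,c,b,a,e,d]]"] C(1) E by (auto simp: packing_def E_commute)
  have i2: "\<not> E a v" using m[of "[[u,v,a,b,c,d,e]]"] C(1) E by (auto simp: packing_def E_commute)
  have i3: "\<not> E e v" using m[of "[[a,b,c,d,e,v,u]]"] C(1) E by (auto simp: packing_def E_commute)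
  have i4: "\<not> E a d" using m[of "[[e,d,a,b,c,u,v]]"] C(1) E by (auto simp: packing_def E_commute)
  have i5: "\<not> E e b" using m[of "[[a,b,e,d,c,u,v]]"] C(1) E by (auto simp: packing_def E_commute)
  have i6: "\<not> E v b" using m[of "[[a,b,v,u],[c,d,e]]"] C(1) E by (auto simp: packing_def E_commute)
  have i7: "\<not> E v d" using m[of "[[a,b,c],[u,v,d,e]]"] C(1) E by (auto simp: packing_def E_commute)
  have i8: "\<not> E a u" using m[of "[[v,u,a,b,c,d,e]]"] C(1) E by (auto simp: packing_def E_commute)
  have i9: "\<not> E e u" using m[of "[[a,b,c,d,e,u,v]]"] C(1) E by (auto simp: packing_def E_commute)
  note indep = i1 i2 i3 i4 i5 i6 i7 i8 i9
  show False
  proof (rule no_obstruction[OF C R max, of a e v])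
    show "nbrs a [a,b,c,d,e,u,v] + nbrs e [a,b,c,d,e,u,v] + nbrs v [a,b,c,d,e,u,v] < length [a,b,c,d,e,u,v]"
      using indep by (auto simp: E_irrefl E_commute)
    fix w assume w: "w \<in> V" "w \<notin> set (concat R)" "w \<notin> set [a,b,c,d,e,u,v]"
      and max: "covers_at_most (set (w # [a,b,c,d,e,u,v])) 5"
    show "\<not> E a w \<and> \<not> E e w \<and> \<not> E v w"
      using max[THEN covers_at_mostD, of "[[w,a,b,c,d,e]]"] max[THEN covers_at_mostD, of "[[a,b,c,d,e,w]]"]
        max[THEN covers_at_mostD, of "[[w,v,u],[a,b,c,d,e]]"] w E C(1) by (auto simp: packing_def E_commute)
  next
    fix Q assume "length Q \<in> {3,4,5}" "successively E Q" "distinct ([a,b,c,d,e,u,v] @ Q)"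
      "covers_at_most (set ([a,b,c,d,e,u,v] @ Q)) (5 + length Q)"
    then show "nbrs a Q + nbrs e Q + nbrs v Q \<le> length Q" using long_spider_nbrs E by blast
  qed (use C(1) indep in auto)
qed

lemma perfect_packing:
  obtains ps where "packing V ps" "set (concat ps) = V"
proof -
  from maximum_packing_exists[OF finite_V] obtain R where R: "compact_packing R"
    "set (concat R) \<subseteq> V" and max: "covers_at_most V (length (concat R))" .
  have "set (concat R) = V"
  proof (rule ccontr)
    assume "set (concat R) \<noteq> V"
    then obtain u where u: "u \<in> V" "u \<notin> set (concat R)" using R(2) by blast
    \<comment> \<open>Singles out the path \<open>Q\<close> through \<open>y\<close>; the remaining
      paths \<open>S\<close> keep the global bound in the form that the obstruction lemmas
      expect.\<close>
    have split: "\<exists>S Q. Q \<in> set R \<and> y \<in> set Q \<and> length Q \<in> {3,4,5} \<and> successively E Q \<and> distinct Q \<and>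
        compact_packing S \<and> set (concat S) \<subseteq> V \<and> set Q \<subseteq> V \<and> set Q \<inter> set (concat S) = {} \<and>
        set (concat S) \<union> set Q = set (concat R) \<and>
        covers_at_most V (length Q + length (concat S))" if y: "y \<in> set (concat R)" for y
    proof -
      obtain Q where "Q \<in> set R" "y \<in> set Q" using y by auto
      then obtain xs ys where R': "R = xs @ Q # ys" by (meson split_list)
      have "compact_packing (xs @ ys)" "length Q \<in> {3,4,5}" "successively E Q" "distinct Q"
          "set Q \<inter> set (concat (xs @ ys)) = {}"
        using R(1) R' by (auto simp: compact_packing_def)
      moreover have sets: "set (concat (xs @ ys)) \<union> set Q = set (concat R)" using R' by auto
      moreover have "length Q + length (concat (xs @ ys)) = length (concat R)" using R' by simp
      then have "covers_at_most V (length Q + length (concat (xs @ ys)))" using max by simp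
      moreover have "set (concat (xs @ ys)) \<subseteq> V" "set Q \<subseteq> V" using sets R(2) by blast+
      ultimately show ?thesis using \<open>Q \<in> set R\<close> \<open>y \<in> set Q\<close> by blast
    qed
    show False
    proof (cases "\<exists>v\<in>V - set (concat R). E u v")
      case False
      have "{u} \<noteq> V" using card_V by auto
      then obtain y where y: "y \<in> V" "E u y" using cut_edge[of "{u}"] u by auto
      with False have "y \<in> set (concat R)" by auto
      from split[OF this] obtain S Q where Q: "y \<in> set Q" "length Q \<in> {3,4,5}" "successively E Q"
          "distinct Q" "set Q \<subseteq> V" "set Q \<inter> set (concat S) = {}"
        and S: "compact_packing S" "set (concat S) \<subseteq> V" "set (concat S) \<union> set Q = set (concat R)"
        and max': "covers_at_most V (length Q + length (concat S))" by blast
      have isolated: "\<And>w. w \<in> V \<Longrightarrow> w \<notin> set (concat S) \<Longrightarrow> w \<notin> set Q \<Longrightarrow> \<not> E u w"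
        using False S(3) by blast
      have uQ: "u \<notin> set Q" "u \<notin> set (concat S)" using u S(3) by auto
      have max1: "covers_at_most (set (u # Q)) (length Q)"
        by (rule covers_at_most_block[OF _ _ _ S(1,2) max']) (use Q u uQ in auto)
      show False
        using Q(2)
      proof (cases rule: short_cases)
        case (3 a b c)
        then have len: "length Q = 3" by simp
        note m = max1[THEN covers_at_mostD] and dist = Q(4) uQ(1)
        have "\<not> E u a" using m[of "[[u,a,b,c]]"] dist Q(3) 3 by (auto simp: packing_def E_commute)
        moreover have "\<not> E u c" using m[of "[[a,b,c,u]]"] dist Q(3) 3 by (auto simp: packing_def E_commute)
        ultimately have yb: "y = b" using Q(1) y(2) 3 by auto
        show False
          by (rule star_obstruction[OF _ _ _ S(1,2) max'[unfolded len] _ _ _ isolated[unfolded 3]])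
            (use Q y yb u uQ 3 in auto)
      next
        case (4 a b c d)
        then have len: "length Q = 4" by simp
        note m = max1[THEN covers_at_mostD] and dist = Q(4) uQ(1)
        have "\<not> E u a" using m[of "[[u,a,b,c,d]]"] dist Q(3) 4 by (auto simp: packing_def E_commute)
        moreover have "\<not> E u d" using m[of "[[a,b,c,d,u]]"] dist Q(3) 4 by (auto simp: packing_def E_commute)
        ultimately have "y = b \<or> y = c" using Q(1) y(2) 4 by auto
        then show False
        proof
          assume yb: "y = b"
          show False
            by (rule fork_obstruction[OF _ _ _ S(1,2) max'[unfolded len] _ _ _ _ isolated[unfolded 4]])
              (use Q y yb u uQ 4 in auto)
        next
          assume yc: "y = c"
          \<comment> \<open>The uncovered vertex hangs next to the other end, so the path is read
            backwards.\<close>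
          have isolated': "\<And>w. w \<in> V \<Longrightarrow> w \<notin> set (concat S) \<Longrightarrow> w \<notin> set [d,c,b,a] \<Longrightarrow> \<not> E u w"
            using isolated 4 by auto
          show False
            by (rule fork_obstruction[OF _ _ _ S(1,2) max'[unfolded len] _ _ _ _ isolated'])
              (use Q y yc u uQ 4 in \<open>auto simp: E_commute\<close>)
        qed
      next
        case (5 a b c d e)
        then have len: "length Q = 5" by simp
        note m = max1[THEN covers_at_mostD] and dist = Q(4) uQ(1)
        have "\<not> E u a" using m[of "[[u,a,b,c,d,e]]"] dist Q(3) 5 by (auto simp: packing_def E_commute)
        moreover have "\<not> E u b" using m[of "[[a,b,u],[c,d,e]]"] dist Q(3) 5 by (auto simp: packing_def E_commute)
        moreover have "\<not> E u d" using m[of "[[a,b,c],[u,d,e]]"] dist Q(3) 5 by (auto simp: packing_def E_commute)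
        moreover have "\<not> E u e" using m[of "[[a,b,c,d,e,u]]"] dist Q(3) 5 by (auto simp: packing_def E_commute)
        ultimately have yc: "y = c" using Q(1) y(2) 5 by auto
        show False
          by (rule spider_obstruction[OF _ _ _ S(1,2) max'[unfolded len] _ _ _ _ _ isolated[unfolded 5]])
            (use Q y yc u uQ 5 in auto)
      qed
    next
      case True
      then obtain v where v: "v \<in> V" "v \<notin> set (concat R)" "E u v" by auto
      have "{u,v} \<noteq> V" using card_V card_2_iff[of "{u,v}"] by (cases "u = v") auto
      \<comment> \<open>The edge leaving \<open>{u,v}\<close> may start at either vertex:
        \<open>s\<close> is the one it starts at, \<open>t\<close> will be the other.\<close>
      then obtain s y where s: "s \<in> {u,v}" and y: "y \<in> V - {u,v}" "E s y"
        using cut_edge[of "{u,v}"] u v by auto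
      then obtain t where st: "{s,t} = {u,v}" "E t s" using v by (cases "s = u") (auto simp: E_commute)
      have "s \<noteq> t" using st E_irrefl by auto
      have st': "s \<in> V" "t \<in> V" "s \<notin> set (concat R)" "t \<notin> set (concat R)" "y \<noteq> s" "y \<noteq> t"
        using u v st(1) y by (auto simp: doubleton_eq_iff)
      have "y \<in> set (concat R)"
      proof (rule ccontr)
        assume "y \<notin> set (concat R)"
        \<comment> \<open>The bound is 0 because none of the three vertices is covered: the path
          \<open>t, s, y\<close> could simply be added.\<close>
        then have m: "covers_at_most (set [t,s,y]) 0"
          by (intro covers_at_most_block[of "[t,s,y]" R 0]) (use R max st' y \<open>s \<noteq> t\<close> in auto)
        have "packing (set [t,s,y]) [[t,s,y]]"
          using st(2) y(2) \<open>s \<noteq> t\<close> st' by (auto simp: packing_def)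
        from covers_at_mostD[OF m this] show False by simp
      qed
      from split[OF this] obtain S Q where Q: "y \<in> set Q" "length Q \<in> {3,4,5}" "successively E Q"
          "distinct Q" "set Q \<subseteq> V" "set Q \<inter> set (concat S) = {}"
        and S: "compact_packing S" "set (concat S) \<subseteq> V" "set (concat S) \<union> set Q = set (concat R)"
        and max': "covers_at_most V (length Q + length (concat S))" by blast
      have stQ: "s \<notin> set Q" "s \<notin> set (concat S)" "t \<notin> set Q" "t \<notin> set (concat S)"
        using st' S(3) by auto
      have dist: "distinct (t # s # Q)" using stQ Q \<open>s \<noteq> t\<close> by auto
      have max1: "covers_at_most (set (t # s # Q)) (length Q)"
        by (rule covers_at_most_block[OF dist _ _ S(1,2) max']) (use Q st' stQ in auto)
      from edge_nbrs(2)[OF Q(2,3) dist st(2) max1 Q(1) y(2)]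
      have len: "length Q = 5" and y2: "y = Q ! 2" by auto
      then obtain a b c d e where Qc: "Q = [a,b,c,d,e]" "y = c"
        by (auto simp: numeral_eq_Suc length_Suc_conv)
      show False
        by (rule long_spider_obstruction[OF _ _ _ S(1,2) max'[unfolded len], of a b c d e s t])
          (use Q(3-6) Qc y(2) E_sym[OF st(2)] st'(1,2) stQ \<open>s \<noteq> t\<close> in auto)
    qed
  qed
  then show thesis using that[of R] compact_packing_imp_packing[OF R] by blast
qed

end

section \<open>Path factors from packings\<close>

text \<open>For distinct \<open>p\<close> this inverts \<open>nth\<close>; it becomes the vertex map
  of the isomorphism onto \<open>path_graph\<close>.\<close>

definition index_in :: "'a list \<Rightarrow> 'a \<Rightarrow> nat" where
  "index_in p x = the_inv_into {..<length p} (\<lambda>i. p ! i) x"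

lemma index_in_nth: "distinct p \<Longrightarrow> i < length p \<Longrightarrow> index_in p (p ! i) = i"
  unfolding index_in_def by (rule the_inv_into_f_f) (auto simp: inj_on_nth)

lemma inj_on_index_in: "distinct p \<Longrightarrow> inj_on (index_in p) (set p)"
  by (auto simp: inj_on_def in_set_conv_nth index_in_nth)

lemma index_in_image: "distinct p \<Longrightarrow> index_in p ` set p = {..<length p}"
  by (force simp: index_in_nth in_set_conv_nth image_def)

definition path_edge :: "'a list \<Rightarrow> 'a \<Rightarrow> 'a \<Rightarrow> bool" where
  "path_edge p x y \<longleftrightarrow> (\<exists>i. Suc i < length p \<and> (x = p ! i \<and> y = p ! Suc i \<or> y = p ! i \<and> x = p ! Suc i))"

lemma path_edge_sym: "path_edge p x y \<Longrightarrow> path_edge p y x"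
  by (auto simp: path_edge_def)

lemma path_edge_in_set: "path_edge p x y \<Longrightarrow> x \<in> set p \<and> y \<in> set p"
  by (auto simp: path_edge_def)

text \<open>Arcs are selected from \<open>G\<close>, as the arc type is arbitrary. Since
  \<open>path_edge\<close> is symmetric, opposite arcs are kept together.\<close>

definition path_union :: "('a,'b) pre_digraph \<Rightarrow> 'a list list \<Rightarrow> ('a,'b) pre_digraph" where
  "path_union G ps =
    \<lparr> verts = verts G, arcs = {e \<in> arcs G. \<exists>p\<in>set ps. path_edge p (tail G e) (head G e)},
      tail = tail G, head = head G \<rparr>"

lemma path_union_simps [simp]:
  "verts (path_union G ps) = verts G" "tail (path_union G ps) = tail G"
  "head (path_union G ps) = head G"
  "arcs (path_union G ps) = {e \<in> arcs G. \<exists>p\<in>set ps. path_edge p (tail G e) (head G e)}"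
  by (simp_all add: path_union_def)

context graph
begin

sublocale adjacency "\<lambda>x y. x \<rightarrow>\<^bsub>G\<^esub> y"
  using arcs_ends_symmetric[OF sym_arcs] adj_not_same by unfold_locales auto

lemma graph_path_union: "graph (path_union G ps)"
proof -
  have "digraph (path_union G ps)"
    by unfold_locales (auto simp: no_loops arc_to_ends_def intro: no_multi_arcs)
  moreover have "symmetric (path_union G ps)"
    using sym_arcs path_edge_sym unfolding symmetric_conv by fastforce
  ultimately show ?thesis by (rule digraph.graphI)
qed

lemma spanning_path_union: "spanning (path_union G ps) G"
  using graph_path_union[of ps] wf_digraph
  by (auto simp: spanning_def subgraph_def compatible_def graph_def digraph_def fin_digraph_def)

lemma dominates_path_union_iff:
  "x \<rightarrow>\<^bsub>path_union G ps\<^esub> y \<longleftrightarrow> x \<rightarrow>\<^bsub>G\<^esub> y \<and> (\<exists>p\<in>set ps. path_edge p x y)"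
  by (force simp: arcs_ends_conv)

context
  fixes ps assumes ps: "packing (verts G) ps" "set (concat ps) = verts G"
begin

lemma packing_path_eq: "p \<in> set ps \<Longrightarrow> q \<in> set ps \<Longrightarrow> x \<in> set p \<Longrightarrow> x \<in> set q \<Longrightarrow> p = q"
  using ps(1) unfolding packing_def distinct_concat_iff by blast

lemma packing_path:
  assumes "p \<in> set ps"
  shows "3 \<le> length p" "distinct p" "set p \<subseteq> verts G"
    and "Suc i < length p \<Longrightarrow> p ! i \<rightarrow>\<^bsub>G\<^esub> p ! Suc i"
  using ps(1) assms unfolding packing_def distinct_concat_iff
  by (auto simp: successively_conv_nth)

lemma packing_edge: "p \<in> set ps \<Longrightarrow> path_edge p x y \<Longrightarrow> x \<rightarrow>\<^bsub>path_union G ps\<^esub> y"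
  using packing_path(4) E_sym by (auto simp: dominates_path_union_iff path_edge_def)

lemma dominates_path_union_path:
  assumes "p \<in> set ps" "x \<in> set p" "x \<rightarrow>\<^bsub>path_union G ps\<^esub> y"
  shows "path_edge p x y"
  using assms packing_path_eq path_edge_in_set unfolding dominates_path_union_iff by metis

text \<open>The paths are disjoint, so an arc starting on \<open>p\<close> belongs to
  \<open>p\<close>. Conversely \<open>p ! 0\<close> reaches every entry along \<open>p\<close>, and
  symmetry joins any two entries through it.\<close>

lemma reachable_path_union:
  assumes p: "p \<in> set ps" "x \<in> set p"
  shows "x \<rightarrow>\<^sup>*\<^bsub>path_union G ps\<^esub> y \<longleftrightarrow> y \<in> set p"
proof
  interpret H: graph "path_union G ps" by (rule graph_path_union)
  show "x \<rightarrow>\<^sup>*\<^bsub>path_union G ps\<^esub> y \<Longrightarrow> y \<in> set p"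
  proof (induction rule: H.reachable_induct)
    case (step y z)
    then show ?case using dominates_path_union_path[OF p(1)] path_edge_in_set by metis
  qed (use p in simp)
  have hd: "p ! 0 \<rightarrow>\<^sup>*\<^bsub>path_union G ps\<^esub> p ! i" if "i < length p" for i
    using that
  proof (induction i)
    case 0
    then show ?case using packing_path(3)[OF p(1)] by (intro H.reachable_refl) auto
  next
    case (Suc i)
    have "path_edge p (p ! i) (p ! Suc i)" using Suc.prems by (auto simp: path_edge_def)
    then show ?case using Suc H.reachable_adj_trans packing_edge[OF p(1)] by auto
  qed
  assume "y \<in> set p"
  then show "x \<rightarrow>\<^sup>*\<^bsub>path_union G ps\<^esub> y"
    using p(2) hd H.symmetric_reachable' H.reachable_trans by (metis in_set_conv_nth)
qed

lemma iso_path_graph: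
  assumes p: "p \<in> set ps"
  shows "digraph_iso (path_union G ps \<restriction> set p) (with_proj (path_graph (length p)))"
proof -
  let ?H = "path_union G ps" let ?C = "?H \<restriction> set p" let ?i = "index_in p"
  interpret H: graph ?H by (rule graph_path_union)
  define f where "f = \<lparr> iso_verts = ?i, iso_arcs = (\<lambda>e. (?i (tail G e), ?i (head G e))),
    iso_head = snd, iso_tail = fst \<rparr>"
  note dist = packing_path(2)[OF p]
  \<comment> \<open>No other path has an edge with an end on \<open>p\<close>, so inducing on
    \<open>set p\<close> keeps exactly the edges of \<open>p\<close>.\<close>
  have edges: "(\<exists>q\<in>set ps. path_edge q s t) \<and> s \<in> set p \<and> t \<in> set p \<longleftrightarrow> path_edge p s t" for s t
    using p packing_path_eq[OF p, of _ s] path_edge_in_set[of _ s t] by blast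
  have arcs: "arcs ?C = {e \<in> arcs G. path_edge p (tail G e) (head G e)}"
    using edges by auto
  have C: "pre_digraph.digraph_isomorphism ?C f"
    unfolding pre_digraph.digraph_isomorphism_def
  proof (intro conjI ballI)
    show "wf_digraph ?C" using packing_path(3)[OF p] by (intro H.wellformed_induce_subgraph) 
    show "inj_on (iso_verts f) (verts ?C)" using inj_on_index_in[OF dist] by (simp add: f_def)
    show "inj_on (iso_arcs f) (arcs ?C)"
    proof (rule inj_onI)
      fix e e' assume e: "e \<in> arcs ?C" "e' \<in> arcs ?C" "iso_arcs f e = iso_arcs f e'"
      then have "tail G e = tail G e'" "head G e = head G e'"
        using inj_on_index_in[OF dist] by (auto simp: f_def inj_on_def)
      then show "e = e'" using e no_multi_arcs by (auto simp: arc_to_ends_def)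
    qed
  qed (simp_all add: f_def)
  have "iso_arcs f ` arcs ?C = parcs (path_graph (length p))"
  proof (intro equalityI subsetI)
    fix a assume "a \<in> iso_arcs f ` arcs ?C"
    then show "a \<in> parcs (path_graph (length p))" unfolding arcs
      by (auto simp: f_def path_edge_def path_graph_def index_in_nth[OF dist])
  next
    fix a assume "a \<in> parcs (path_graph (length p))"
    then obtain i j where a: "a = (i,j)" "i < length p" "j < length p" "j = Suc i \<or> i = Suc j"
      by (auto simp: path_graph_def)
    then have *: "path_edge p (p ! i) (p ! j)" by (auto simp: path_edge_def)
    then have "p ! i \<rightarrow>\<^bsub>G\<^esub> p ! j" using packing_edge[OF p] dominates_path_union_iff by blast
    then obtain e where "e \<in> arcs G" "tail G e = p ! i" "head G e = p ! j" by auto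
    then show "a \<in> iso_arcs f ` arcs ?C" unfolding arcs using * a
      by (auto simp: f_def index_in_nth[OF dist] intro!: image_eqI[of _ _ e])
  qed
  then have "with_proj (path_graph (length p)) = app_iso f ?C"
    using index_in_image[OF dist]
    by (simp add: app_iso_def f_def with_proj_def) (simp add: path_graph_def)
  then show ?thesis using C unfolding digraph_iso_def by blast
qed

lemma path_factor_path_union: "path_factor 3 (path_union G ps) G"
  unfolding path_factor_def
proof (intro conjI ballI graph_path_union spanning_path_union)
  let ?H = "path_union G ps"
  interpret H: graph ?H by (rule graph_path_union)
  fix C assume "C \<in> H.sccs"
  then obtain S where S: "S \<in> H.sccs_verts" and C: "C = ?H \<restriction> S"
    unfolding H.sccs_conv_sccs_verts by blast
  then obtain x where x: "x \<in> S" by (auto simp: H.sccs_verts_def)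
  then have "x \<rightarrow>\<^sup>*\<^bsub>?H\<^esub> x" using S unfolding H.sccs_verts_def by simp
  then have "x \<in> verts G" using H.reachable_in_verts(1) by fastforce
  then obtain p where p: "p \<in> set ps" "x \<in> set p" using ps(2) by auto
  \<comment> \<open>By symmetry, a strong component is everything reachable from any one of its
    vertices.\<close>
  have "S = {v. x \<rightarrow>\<^sup>*\<^bsub>?H\<^esub> v}"
    using S x H.symmetric_reachable' unfolding H.sccs_verts_def by blast
  then have "S = set p" using reachable_path_union[OF p] by auto
  then show "\<exists>m\<ge>3. digraph_iso C (with_proj (path_graph m))"
    using C iso_path_graph[OF p(1)] packing_path(1)[OF p(1)] by blast
qed

end

section \<open>Connectivity and degrees under deletion of vertices\<close>

lemma graph_induce: "W \<subseteq> verts G \<Longrightarrow> graph (G \<restriction> W)"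
  by (metis digraph.graphI digraphI_induced induced_graph_imp_symmetric induced_induce sym_arcs)

text \<open>A set that no arc leaves is closed under reachability, while symmetry makes a connected
  graph strongly connected.\<close>

lemma connected_cut_arc:
  assumes "connected G" "A \<subseteq> verts G" "A \<noteq> {}" "A \<noteq> verts G"
  shows "\<exists>x\<in>A. \<exists>y\<in>verts G - A. x \<rightarrow>\<^bsub>G\<^esub> y"
proof (rule ccontr)
  assume none: "\<not> ?thesis"
  obtain a b where ab: "a \<in> A" "b \<in> verts G - A" using assms by blast
  have "a \<rightarrow>\<^sup>*\<^bsub>G\<^esub> b"
    using symmetric_connected_imp_strongly_connected[OF sym_arcs assms(1)] ab assms(2) by auto
  then have "b \<in> A"
  proof (induction rule: reachable_induct)
    case (step x y)
    then show ?case using none adj_in_verts by blast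
  qed (use ab in simp)
  with ab show False by simp
qed

lemma out_degree_eq_card_nbrs: "out_degree G x = card {w\<in>verts G. x \<rightarrow>\<^bsub>G\<^esub> w}"
proof -
  have "bij_betw (head G) (out_arcs G x) {w\<in>verts G. x \<rightarrow>\<^bsub>G\<^esub> w}"
    by (auto simp: bij_betw_def inj_on_def arcs_ends_conv arc_to_ends_def intro!: no_multi_arcs)
  then show ?thesis unfolding out_degree_def by (rule bij_betw_same_card)
qed

lemma dominates_induce_iff: "x \<rightarrow>\<^bsub>G \<restriction> W\<^esub> y \<longleftrightarrow> x \<in> W \<and> y \<in> W \<and> x \<rightarrow>\<^bsub>G\<^esub> y"
  by (force simp: arcs_ends_conv)

lemma out_degree_le_induce:
  assumes "W \<subseteq> verts G"
  shows "out_degree G x \<le> card {w\<in>W. x \<rightarrow>\<^bsub>G\<^esub> w} + card (verts G - W)"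
proof -
  have "card {w\<in>verts G. x \<rightarrow>\<^bsub>G\<^esub> w} \<le> card ({w\<in>W. x \<rightarrow>\<^bsub>G\<^esub> w} \<union> (verts G - W))"
    using assms by (intro card_mono) (auto intro: finite_subset)
  also have "\<dots> \<le> card {w\<in>W. x \<rightarrow>\<^bsub>G\<^esub> w} + card (verts G - W)" by (rule card_Un_le)
  finally show ?thesis by (simp add: out_degree_eq_card_nbrs)
qed

lemma vertex_connectivity_le:
  assumes "\<not> complete_digraph (card (verts G)) G" "S \<subset> verts G" "\<not> connected (G \<restriction> (verts G - S))"
  shows "vertex_connectivity G \<le> card S"
proof -
  have "finite {card S | S. S \<subset> verts G \<and> \<not> connected (G \<restriction> (verts G - S))}"
    by (rule finite_subset[of _ "card ` Pow (verts G)"]) auto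
  then show ?thesis using assms unfolding vertex_connectivity_def by (auto intro: Min_le)
qed

lemma degree_sum_le:
  assumes "independent_set G X"
  shows "degree_sum (card X) G \<le> (\<Sum>x\<in>X. out_degree G x)"
proof -
  have "finite {\<Sum>x\<in>Y. out_degree G x | Y. independent_set G Y \<and> card Y = card X}"
    by (rule finite_subset[of _ "(\<lambda>Y. \<Sum>x\<in>Y. out_degree G x) ` Pow (verts G)"])
      (auto simp: independent_set_def)
  then show ?thesis using assms unfolding degree_sum_def by (auto intro: Min_le)
qed

text \<open>All vertices but \<open>a\<close> and \<open>b\<close> form a separating set. With
  connectivity at least \<open>l + 1\<close>, the bound guarantees that three vertices survive the
  deletion of \<open>l\<close>.\<close>

lemma vertex_connectivity_nonadjacent:
  assumes "a \<in> verts G" "b \<in> verts G" "a \<noteq> b" "\<not> a \<rightarrow>\<^bsub>G\<^esub> b"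
  shows "\<not> complete_digraph (card (verts G)) G" "vertex_connectivity G + 2 \<le> card (verts G)"
proof -
  show nc: "\<not> complete_digraph (card (verts G)) G"
    using assms by (auto simp: complete_digraph_def)
  let ?S = "verts G - {a,b}"
  have S: "verts G - ?S = {a,b}" using assms by auto
  have "\<not> connected (G \<restriction> {a,b})"
  proof
    assume conn: "connected (G \<restriction> {a,b})"
    interpret K: graph "G \<restriction> {a,b}" using assms by (intro graph_induce) auto
    have "\<exists>x\<in>{a}. \<exists>y\<in>verts (G \<restriction> {a,b}) - {a}. x \<rightarrow>\<^bsub>G \<restriction> {a,b}\<^esub> y"
      by (rule K.connected_cut_arc[OF conn]) (use assms in auto)
    then show False using assms by (auto simp: dominates_induce_iff)
  qed
  then have "vertex_connectivity G \<le> card ?S"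
    using assms(1) S by (intro vertex_connectivity_le[OF nc]) auto
  moreover have "card ?S = card (verts G) - card {a,b}" "card {a,b} \<le> card (verts G)"
    using assms card_Diff_subset[of "{a,b}" "verts G"] card_mono[of "verts G" "{a,b}"] by simp_all
  ultimately show "vertex_connectivity G + 2 \<le> card (verts G)" using assms(3) by simp
qed

end

theorem theorem6:
  fixes G :: "('a,'b) pre_digraph" and l n :: nat
  assumes "l \<ge> 1"
    and "graph G"
    and "card (verts G) = n"
    and "\<exists>X. independent_set G X \<and> card X = 3"
    and "vertex_connectivity G \<ge> l + 1"
    and "degree_sum 3 G \<ge> n + 2 * l"
  shows "path_factor_critical 3 l G"
  unfolding path_factor_critical_def
proof (intro allI impI)
  interpret graph G by fact
  fix S assume S: "S \<subseteq> verts G" "card S = l"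
  let ?W = "verts G - S" let ?K = "G \<restriction> ?W"
  interpret K: graph ?K by (rule graph_induce) auto
  from assms(4) obtain a b where "a \<in> verts G" "b \<in> verts G" "a \<noteq> b" "\<not> a \<rightarrow>\<^bsub>G\<^esub> b"
    by (auto simp: independent_set_def card_3_iff)
  note ab = vertex_connectivity_nonadjacent[OF this]
  have W: "card ?W = n - l" "l + 3 \<le> n" "verts G - ?W = S"
    using S assms(3,5) ab(2) finite_subset[OF S(1)] by (auto simp: card_Diff_subset)
  then have "S \<subset> verts G" using S assms(3) by auto
  then have conn: "connected ?K"
    using vertex_connectivity_le[OF ab(1), of S] S(2) assms(5) by auto
  interpret K: sigma3_graph "\<lambda>x y. x \<rightarrow>\<^bsub>?K\<^esub> y" ?W
  proof
    show "\<exists>x\<in>A. \<exists>y\<in>?W - A. x \<rightarrow>\<^bsub>?K\<^esub> y" if "A \<subseteq> ?W" "A \<noteq> {}" "A \<noteq> ?W" for A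
      using K.connected_cut_arc[OF conn] that by auto
    fix x y z assume xyz: "x \<in> ?W" "y \<in> ?W" "z \<in> ?W" "x \<noteq> y" "x \<noteq> z" "y \<noteq> z"
      "\<not> x \<rightarrow>\<^bsub>?K\<^esub> y" "\<not> x \<rightarrow>\<^bsub>?K\<^esub> z" "\<not> y \<rightarrow>\<^bsub>?K\<^esub> z"
    let ?d = "\<lambda>t. card {w\<in>?W. t \<rightarrow>\<^bsub>?K\<^esub> w}"
    have deg: "out_degree G t \<le> ?d t + l" if "t \<in> ?W" for t
    proof -
      have "{w\<in>?W. t \<rightarrow>\<^bsub>?K\<^esub> w} = {w\<in>?W. t \<rightarrow>\<^bsub>G\<^esub> w}" using that by (auto simp: dominates_induce_iff)
      then show ?thesis using out_degree_le_induce[of ?W t] W(3) S(2) by auto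
    qed
    have "independent_set G {x,y,z}"
      using xyz E_sym E_irrefl by (auto simp: independent_set_def dominates_induce_iff)
    from degree_sum_le[OF this] xyz(4-6)
    have "degree_sum 3 G \<le> out_degree G x + out_degree G y + out_degree G z"
      by (simp add: numeral_3_eq_3)
    also have "\<dots> \<le> ?d x + ?d y + ?d z + 3 * l"
      using deg[OF xyz(1)] deg[OF xyz(2)] deg[OF xyz(3)] by simp
    \<comment> \<open>The three degrees in \<open>G\<close> sum to at least \<open>n + 2 * l\<close>
      and the deletion costs at most \<open>3 * l\<close>, which leaves at least
      \<open>n - l\<close>, the order of the remaining graph.\<close>
    finally show "card ?W \<le> ?d x + ?d y + ?d z" using assms(6) W by simp
  qed (use W in auto)
  obtain ps where "K.packing ?W ps" "set (concat ps) = ?W" by (rule K.perfect_packing)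
  then show "\<exists>H. path_factor 3 H ?K" using K.path_factor_path_union[of ps] by auto
qed

end
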